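(* Let $A\in\mathbb{R}_{\min}^{n\times n}$ be a min-plus matrix such that all circuits in the associated network $\mathcal{N}(A)$ are separated, i.e. every vertex of $\mathcal{N}(A)$ belongs to at most one circuit. Suppose that the characteristic polynomial $g_A(x)=\mathrm{tropdet}(A\oplus x\otimes I)$ can be factorized into linear factors as $$g_A(x)\equiv (x\oplus\tilde p_1)^{\tilde\ell_1}\otimes (x\oplus\tilde p_2)^{\tilde\ell_2}\otimes\cdots\otimes (x\oplus\tilde p_k)^{\tilde\ell_k}\otimes x^r,$$ where $\tilde p_1<\tilde p_2<\cdots<\tilde p_k$ are real numbers, $\tilde\ell_1,\dots,\tilde\ell_k$ are positive integers, and $r=n-(\tilde\ell_1+\cdots+\tilde\ell_k)\ge 0$. Then there exist in $\mathcal{N}(A)$ homogeneous extended circuits $\tilde C(\tilde\ell_1,\tilde p_1),\tilde C(\tilde\ell_2,\tilde p_2),\dots,\tilde C(\tilde\ell_k,\tilde p_k)$; that is, for each $i$ there is a homogeneous extended circuit of length $\tilde\ell_i$ and average weight $\tilde p_i$.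
   Context: Min-plus algebra: $\mathbb{R}_{\min}=\mathbb{R}\cup\{+\infty\}$ with $a\oplus b=\min\{a,b\}$, $a\otimes b=a+b$; $\varepsilon=+\infty$ is the identity for $\oplus$ (and absorbing for $\otimes$), $e=0$ is the identity for $\otimes$. Powers are with respect to $\otimes$: $x^m=x\otimes\cdots\otimes x$ ($m$ times) $=mx$, and $x^0=0$; similarly $(x\oplus p)^m=m\min\{x,p\}$. For matrices, $[A\oplus B]_{ij}=a_{ij}\oplus b_{ij}$ and $[\alpha\otimes A]_{ij}=\alpha\otimes a_{ij}$. $I$ is the $n\times n$ matrix with $0$ on the diagonal and $\varepsilon$ elsewhere. Tropical determinant: $\mathrm{tropdet}(A)=\bigoplus_{\sigma\in S_n}a_{1\sigma(1)}\otimes a_{2\sigma(2)}\otimes\cdots\otimes a_{n\sigma(n)}$, where $S_n$ is the symmetric group on $\{1,\dots,n\}$. Min-plus polynomials $p(x)$ are also regarded as (piecewise linear) functions of $x$. $p(x)\equiv p'(x)$ (equivalence) means that $p$ and $p'$ have the same factorization into linear factors, i.e. that they define the same function of $x\in\mathbb{R}_{\min}$, even though their coefficients may differ. Network: for $A=(a_{ij})\in\mathbb{R}_{\min}^{n\times n}$, $\mathcal{N}(A)$ is the directed weighted graph with vertices $v_1,\dots,v_n$ and an edge from $v_i$ to $v_j$ of weight $a_{ij}$ exactly when $a_{ij}\neq\varepsilon$ (loops $i=j$ allowed). A circuit is a closed directed path $(v_{i(0)},v_{i(1)},\dots,v_{i(s)})$, $s\ge 1$, with $i(s)=i(0)$ and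 $i(0),\dots,i(s-1)$ pairwise distinct (a loop is a circuit of length 1); circuits differing only by the choice of starting vertex are the same. Its length is $\ell(C)=s$, its weight sum is $\omega(C)=\sum_{t=0}^{s-1}a_{i(t)i(t+1)}$, and its average weight is $\omega(C)/\ell(C)$. An extended circuit is a set of pairwise vertex-disjoint circuits; its length is the sum of the lengths of its circuits, its weight sum is the sum of their weight sums, and its average weight is weight sum divided by length. $\tilde C(\tilde\ell,\tilde p)$ denotes an extended circuit of length $\tilde\ell$ and average weight $\tilde p$. It is homogeneous if all circuits in it have the same average weight $\tilde p$. *)

theory Defs
  imports
    "HOL-Analysis.Finite_Cartesian_Product"
    "HOL-Combinatorics.Permutations"
    "Graph_Theory.Weighted_Graph"
begin

section \<open>Min-plus algebra\<close>

text \<open>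
  The set of reals extended by \<open>+\<infinity>\<close>, as a commutative semiring.  Semiring notation is used
  throughout with its min-plus meaning: \<open>+\<close> is the minimum, \<open>*\<close> is real addition,
  \<open>0\<close> is \<open>PInf\<close> and \<open>1\<close> is \<open>Fin 0\<close>.  Hence \<open>\<Sum>\<close> is a minimum,
  \<open>\<Prod>\<close> is a sum of reals, \<open>x ^ m\<close> is the \<open>m\<close>-fold real multiple, and the
  library matrix \<open>mat 1\<close> has \<open>Fin 0\<close> on the diagonal and \<open>PInf\<close> elsewhere.
\<close>

datatype minplus = Fin real | PInf

instantiation minplus :: comm_semiring_1
begin

definition zero_minplus :: minplus where
  "0 = PInf"

definition one_minplus :: minplus where
  "1 = Fin 0"

fun plus_minplus :: "minplus \<Rightarrow> minplus \<Rightarrow> minplus" where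
  "Fin a + Fin b = Fin (min a b)"
| "PInf + y = y"
| "x + PInf = x"

fun times_minplus :: "minplus \<Rightarrow> minplus \<Rightarrow> minplus" where
  "Fin a * Fin b = Fin (a + b)"
| "PInf * y = PInf"
| "x * PInf = PInf"

instance
proof
  fix a b c :: minplus
  show "a + b + c = a + (b + c)" by (cases a; cases b; cases c) auto
  show "a + b = b + a" by (cases a; cases b) auto
  show "0 + a = a" by (simp add: zero_minplus_def)
  show "a * b * c = a * (b * c)" by (cases a; cases b; cases c) auto
  show "a * b = b * a" by (cases a; cases b) auto
  show "1 * a = a" by (cases a) (auto simp: one_minplus_def)
  show "(a + b) * c = a * c + b * c"
    by (cases a; cases b; cases c) (auto simp: min_def)
  show "0 * a = 0" by (simp add: zero_minplus_def)
  show "a * 0 = 0" by (cases a) (auto simp: zero_minplus_def)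
  show "(0::minplus) \<noteq> 1" by (simp add: zero_minplus_def one_minplus_def)
qed

end

lemma Fin_power: "Fin a ^ m = Fin (real m * a)"
  by (induction m) (auto simp: one_minplus_def algebra_simps)

definition scale_matrix :: "minplus \<Rightarrow> minplus ^ 'n ^ 'm \<Rightarrow> minplus ^ 'n ^ 'm" where
  "scale_matrix \<alpha> A = (\<chi> i j. \<alpha> * A $ i $ j)"

definition tropdet :: "minplus ^ 'n ^ 'n \<Rightarrow> minplus" where
  "tropdet A = (\<Sum>\<sigma> | \<sigma> permutes UNIV. \<Prod>i\<in>UNIV. A $ i $ \<sigma> i)"

text \<open>
  Two min-plus polynomials are equivalent iff they agree as functions on \<open>minplus\<close>, so the
  characteristic polynomial is represented by its function.
\<close>

definition char_fun :: "minplus ^ 'n ^ 'n \<Rightarrow> minplus \<Rightarrow> minplus" where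
  "char_fun A x = tropdet (A + scale_matrix x (mat 1))"


section \<open>Network and circuits\<close>

definition network :: "minplus ^ 'n ^ 'n \<Rightarrow> ('n, 'n \<times> 'n) pre_digraph" where
  "network A = \<lparr>verts = UNIV, arcs = {(i, j). A $ i $ j \<noteq> PInf}, tail = fst, head = snd\<rparr>"

text \<open>Only used on arcs of the network; the value at \<open>PInf\<close> is irrelevant.\<close>

primrec real_of_minplus :: "minplus \<Rightarrow> real" where
  "real_of_minplus (Fin a) = a"
| "real_of_minplus PInf = 0"

definition arc_weight :: "minplus ^ 'n ^ 'n \<Rightarrow> ('n \<times> 'n) weight_fun" where
  "arc_weight A e = real_of_minplus (A $ fst e $ snd e)"

text \<open>
  \<open>pre_digraph.cycle\<close> describes a closed path with distinct vertices as the list of its arcs,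
  from a chosen starting vertex (loops allowed).  A circuit forgets the starting vertex and is
  represented by the set of arcs.  Lemmas \<open>circuit_eq_iff_rotate\<close>,
  \<open>circuit_length_set\<close> and \<open>circuit_weight_set\<close> below justify this encoding.
\<close>

definition circuits :: "minplus ^ 'n ^ 'n \<Rightarrow> ('n \<times> 'n) set set" where
  "circuits A = {set c | c. pre_digraph.cycle (network A) c}"

definition circuit_verts :: "('n \<times> 'n) set \<Rightarrow> 'n set" where
  "circuit_verts C = fst ` C"

definition circuit_length :: "('n \<times> 'n) set \<Rightarrow> nat" where
  "circuit_length C = card C"

definition circuit_weight :: "minplus ^ 'n ^ 'n \<Rightarrow> ('n \<times> 'n) set \<Rightarrow> real" where
  "circuit_weight A C = (\<Sum>e\<in>C. arc_weight A e)"

definition circuit_average :: "minplus ^ 'n ^ 'n \<Rightarrow> ('n \<times> 'n) set \<Rightarrow> real" where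
  "circuit_average A C = circuit_weight A C / real (circuit_length C)"

definition circuits_separated :: "minplus ^ 'n ^ 'n \<Rightarrow> bool" where
  "circuits_separated A \<longleftrightarrow> (\<forall>v. \<exists>\<^sub>\<le>\<^sub>1 C. C \<in> circuits A \<and> v \<in> circuit_verts C)"

definition extended_circuit :: "minplus ^ 'n ^ 'n \<Rightarrow> ('n \<times> 'n) set set \<Rightarrow> bool" where
  "extended_circuit A E \<longleftrightarrow>
     E \<subseteq> circuits A \<and> pairwise (\<lambda>C D. disjnt (circuit_verts C) (circuit_verts D)) E"

definition ext_length :: "('n \<times> 'n) set set \<Rightarrow> nat" where
  "ext_length E = (\<Sum>C\<in>E. circuit_length C)"

definition ext_weight :: "minplus ^ 'n ^ 'n \<Rightarrow> ('n \<times> 'n) set set \<Rightarrow> real" where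
  "ext_weight A E = (\<Sum>C\<in>E. circuit_weight A C)"

definition ext_average :: "minplus ^ 'n ^ 'n \<Rightarrow> ('n \<times> 'n) set set \<Rightarrow> real" where
  "ext_average A E = ext_weight A E / real (ext_length E)"

definition homogeneous :: "minplus ^ 'n ^ 'n \<Rightarrow> ('n \<times> 'n) set set \<Rightarrow> bool" where
  "homogeneous A E \<longleftrightarrow> (\<forall>C\<in>E. circuit_average A C = ext_average A E)"


section \<open>Circuits as arc sets\<close>

lemma wf_digraph_network: "wf_digraph (network A)"
  by unfold_locales (auto simp: network_def)

lemma network_cas_verts:
  assumes "pre_digraph.cas (network A) u c v"
  shows "pre_digraph.awalk_verts (network A) u c = u # map snd c"
  using assms
  by (induction c arbitrary: u)
    (auto simp: pre_digraph.cas.simps pre_digraph.awalk_verts.simps network_def)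

lemma network_cas_map_fst:
  assumes "pre_digraph.cas (network A) u c v"
  shows "map fst c @ [v] = u # map snd c"
  using assms
  by (induction c arbitrary: u) (auto simp: pre_digraph.cas.simps network_def)

lemma network_cycleD:
  assumes "pre_digraph.cycle (network A) c"
  shows "c \<noteq> []" and "distinct (map fst c)"
    and "\<And>t. t < length c \<Longrightarrow> snd (c ! t) = fst (c ! (Suc t mod length c))"
proof -
  obtain u where cas: "pre_digraph.cas (network A) u c u" and ne: "c \<noteq> []"
    and d: "distinct (tl (pre_digraph.awalk_verts (network A) u c))"
    using assms by (auto simp: pre_digraph.cycle_def pre_digraph.awalk_def)
  have eq: "map fst c @ [u] = u # map snd c" by (rule network_cas_map_fst[OF cas])
  have ds: "distinct (map snd c)" using d by (simp add: network_cas_verts[OF cas])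
  show "c \<noteq> []" by fact
  have "mset (map fst c @ [u]) = mset (u # map snd c)" using eq by simp
  then have "mset (map fst c) = mset (map snd c)" by simp
  then show "distinct (map fst c)" using ds mset_eq_imp_distinct_iff by blast
  show "snd (c ! t) = fst (c ! (Suc t mod length c))" if t: "t < length c" for t
  proof -
    have s: "(map fst c @ [u]) ! Suc t = snd (c ! t)"
      unfolding eq using t by simp
    have z: "fst (c ! 0) = u"
      using arg_cong[OF eq, of hd] ne by (simp add: hd_append hd_conv_nth[symmetric] hd_map)
    show ?thesis
      using s t z by (cases "Suc t = length c") (auto simp: nth_append)
  qed
qed

lemma circuit_eq_iff_rotate:
  assumes c: "pre_digraph.cycle (network A) c" and d: "pre_digraph.cycle (network A) d"
  shows "set c = set d \<longleftrightarrow> (\<exists>m. d = rotate m c)"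
proof
  assume eq: "set c = set d"
  note C = network_cycleD[OF c] and D = network_cycleD[OF d]
  have len: "length c = length d"
    using eq C(2) D(2) distinct_card[of c] distinct_card[of d] by (simp add: distinct_map)
  let ?n = "length c"
  have n: "?n > 0" using C(1) by simp
  have "d ! 0 \<in> set c" using eq D(1) by simp
  then obtain m where m: "m < ?n" "c ! m = d ! 0" by (auto simp: in_set_conv_nth)
  have inj: "inj_on fst (set c)" using C(2) by (simp add: distinct_map)
  have "t < ?n \<Longrightarrow> d ! t = c ! ((m + t) mod ?n)" for t
  proof (induction t)
    case 0
    then show ?case using m by simp
  next
    case (Suc t)
    have "fst (d ! Suc t) = snd (d ! t)"
      using D(3)[of t] Suc.prems len by simp
    also have "\<dots> = snd (c ! ((m + t) mod ?n))" using Suc by simp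
    also have "\<dots> = fst (c ! (Suc ((m + t) mod ?n) mod ?n))"
      using C(3) n by simp
    also have "Suc ((m + t) mod ?n) mod ?n = (m + Suc t) mod ?n"
      by (simp add: mod_Suc_eq)
    finally have f: "fst (d ! Suc t) = fst (c ! ((m + Suc t) mod ?n))" .
    have "d ! Suc t \<in> set c" using eq Suc.prems len by simp
    moreover have "c ! ((m + Suc t) mod ?n) \<in> set c" using n by simp
    ultimately show ?case using inj f by (meson inj_onD)
  qed
  then have "d = rotate m c"
    using len by (intro nth_equalityI) (auto simp: nth_rotate)
  then show "\<exists>m. d = rotate m c" ..
qed auto

lemma circuit_length_set:
  "pre_digraph.cycle (network A) c \<Longrightarrow> circuit_length (set c) = length c"
  using network_cycleD(2)[of A c] by (simp add: circuit_length_def distinct_card distinct_map)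

lemma circuit_weight_set:
  "pre_digraph.cycle (network A) c \<Longrightarrow>
   circuit_weight A (set c) = wf_digraph.awalk_cost (arc_weight A) c"
  using network_cycleD(2)[of A c]
  by (simp add: circuit_weight_def wf_digraph.awalk_cost_def[OF wf_digraph_network]
      sum.distinct_set_conv_list distinct_map)

end

theory Submission
  imports Defs "HOL-Combinatorics.Orbits"
begin

text \<open>
  The characteristic function of a matrix with separated circuits can be computed exactly.
  Let \<open>x\<close> be real.  The cycles of a permutation of finite weight for \<open>A \<oplus> x \<otimes> I\<close> are circuits of
  the network and fixed vertices, where the entry is \<open>x\<close> or the weight of the loop.  The circuits have disjoint
  vertex sets, so the choice between going round \<open>C\<close> and fixing all its vertices is made
  independently for each \<open>C\<close>; the cheaper choice costs \<open>\<ell>(C) \<cdot> min(x, p(C))\<close>, where \<open>p(C)\<close> is the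
  average weight of \<open>C\<close>.  A vertex on no circuit is fixed by every such permutation, and has no
  loop, so it always costs \<open>x\<close>.  Altogether (\<open>char_fun_separated\<close>)
  \<open>g\<^sub>A(x) = \<Sum>\<^sub>C \<ell>(C) \<cdot> min(x, p(C)) + c \<cdot> x\<close>,
  where \<open>c\<close> is the number of vertices on no circuit.

  The given factorization says \<open>g\<^sub>A(x) = \<Sum>\<^sub>i \<ell>\<^sub>i min(x, p\<^sub>i) + r x\<close>.  The drop of the slope of such
  a function at a point \<open>q\<close> is the total coefficient of the terms with breakpoint \<open>q\<close>
  (\<open>breakpoint_weights_unique\<close>).  At \<open>q = p\<^sub>i\<close> this gives \<open>\<ell>\<^sub>i\<close> on one side, because the \<open>p\<^sub>i\<close> are
  distinct, and on the other side the total length of the circuits of average weight \<open>p\<^sub>i\<close>.  So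
  the set of all these circuits is the required homogeneous extended circuit.
\<close>

section \<open>Sums and products of min-plus numbers\<close>

lemma prod_Fin: "(\<Prod>i\<in>S. Fin (f i)) = Fin (\<Sum>i\<in>S. f i)"
  by (induction S rule: infinite_finite_induct) (auto simp: one_minplus_def)

lemma prod_eq_FinD:
  assumes "(\<Prod>i\<in>S. f i) = Fin w" "finite S" "i \<in> S"
  shows "f i \<noteq> PInf"
proof
  assume "f i = PInf"
  then have "(\<Prod>i\<in>S. f i) = 0"
    using assms(2,3) by (intro prod_zero) (auto simp: zero_minplus_def)
  then show False using assms(1) by (simp add: zero_minplus_def)
qed

lemma Fin_plus_sum:
  assumes "finite S" "\<And>s w. s \<in> S \<Longrightarrow> f s = Fin w \<Longrightarrow> v \<le> w"
  shows "Fin v + sum f S = Fin v"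
  using assms
proof (induction S)
  case empty
  then show ?case by (simp add: zero_minplus_def)
next
  case (insert s S)
  have "Fin v + f s = Fin v" using insert.prems[of s] by (cases "f s") auto
  moreover have "Fin v + sum f S = Fin v" using insert.prems by (intro insert.IH) auto
  ultimately show ?case using insert.hyps by (simp add: add.assoc[symmetric])
qed

lemma sum_eq_Fin:
  assumes "finite S" "s \<in> S" "f s = Fin v"
    and "\<And>t w. t \<in> S \<Longrightarrow> f t = Fin w \<Longrightarrow> v \<le> w"
  shows "sum f S = Fin v"
proof -
  have "Fin v + sum f (S - {s}) = Fin v" using assms by (intro Fin_plus_sum) auto
  then show ?thesis using assms by (simp add: sum.remove)
qed

text \<open>
  A tropical determinant is evaluated by naming one optimal permutation; permutations that meet
  an infinite entry do not compete, hence only those with real entries \<open>u\<close> have to be bounded.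
\<close>

lemma tropdet_eq_Fin:
  fixes M :: "minplus ^ 'n ^ 'n"
  assumes \<sigma>: "\<sigma> permutes UNIV" "\<And>i. M $ i $ \<sigma> i = Fin (w i)" "(\<Sum>i\<in>UNIV. w i) = v"
    and least: "\<And>\<tau> u. \<tau> permutes UNIV \<Longrightarrow> (\<And>i. M $ i $ \<tau> i = Fin (u i)) \<Longrightarrow>
                  v \<le> (\<Sum>i\<in>UNIV. u i)"
  shows "tropdet M = Fin v"
  unfolding tropdet_def
proof (rule sum_eq_Fin[of _ \<sigma>])
  show "finite {\<sigma>::'n \<Rightarrow> 'n. \<sigma> permutes UNIV}" by (rule finite_permutations) simp
  show "\<sigma> \<in> {\<sigma>. \<sigma> permutes UNIV}" using \<sigma> by simp
  show "(\<Prod>i\<in>UNIV. M $ i $ \<sigma> i) = Fin v" using \<sigma> by (simp add: prod_Fin)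
next
  fix \<tau> :: "'n \<Rightarrow> 'n" and t
  assume \<tau>: "\<tau> \<in> {\<sigma>. \<sigma> permutes UNIV}" and t: "(\<Prod>i\<in>UNIV. M $ i $ \<tau> i) = Fin t"
  have "\<exists>u. M $ i $ \<tau> i = Fin u" for i
    using prod_eq_FinD[OF t, of i] by (cases "M $ i $ \<tau> i") auto
  then obtain u where u: "\<And>i. M $ i $ \<tau> i = Fin (u i)" by metis
  then have "t = (\<Sum>i\<in>UNIV. u i)" using t by (simp add: prod_Fin)
  then show "v \<le> t" using least[of \<tau> u] \<tau> u by simp
qed

definition char_matrix :: "minplus ^ 'n ^ 'n \<Rightarrow> minplus \<Rightarrow> minplus ^ 'n ^ 'n" where
  "char_matrix A x = A + scale_matrix x (mat 1)"

lemma char_fun_eq_tropdet: "char_fun A x = tropdet (char_matrix A x)"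
  by (simp add: char_fun_def char_matrix_def)

lemma char_matrix_nth:
  "char_matrix A x $ i $ j = (if i = j then A $ i $ j + x else A $ i $ j)"
  by (simp add: char_matrix_def scale_matrix_def mat_def)


section \<open>Circuits as arc sets closed under a successor map\<close>

lemma circuitD:
  assumes "C \<in> circuits A"
  shows "C \<noteq> {}" "inj_on fst C" "snd ` C = fst ` C" "\<And>i j. (i, j) \<in> C \<Longrightarrow> A $ i $ j \<noteq> PInf"
proof -
  obtain c where C: "C = set c" and c: "pre_digraph.cycle (network A) c"
    using assms by (auto simp: circuits_def)
  note cyc = network_cycleD[OF c]
  show "C \<noteq> {}" "inj_on fst C" using cyc C by (auto simp: distinct_map)
  obtain u where cas: "pre_digraph.cas (network A) u c u" and arcs: "set c \<subseteq> arcs (network A)"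
    using c by (auto simp: pre_digraph.cycle_def pre_digraph.awalk_def)
  have "mset (map fst c @ [u]) = mset (u # map snd c)"
    using network_cas_map_fst[OF cas] by simp
  then have "mset (map fst c) = mset (map snd c)" by simp
  then have "set (map fst c) = set (map snd c)" by (rule mset_eq_setD)
  then show "snd ` C = fst ` C" using C by simp
  show "A $ i $ j \<noteq> PInf" if "(i, j) \<in> C" for i j
    using that arcs C by (auto simp: network_def)
qed

text \<open>
  Iterating \<open>\<sigma>\<close> from \<open>i\<close> gives an arc sequence that is linked head to tail, whether or not its
  pairs are arcs; closing up and finiteness of the entries are dealt with separately.
\<close>

lemma cas_funpow:
  "pre_digraph.cas (network A) i
     (map (\<lambda>t. ((\<sigma> ^^ t) i, (\<sigma> ^^ Suc t) i)) [0..<m]) ((\<sigma> ^^ m) i)"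
proof (induction m arbitrary: i)
  case 0
  then show ?case by (simp add: pre_digraph.cas.simps)
next
  case (Suc m)
  have "map (\<lambda>t. ((\<sigma> ^^ t) i, (\<sigma> ^^ Suc t) i)) [0..<Suc m] =
        (i, \<sigma> i) # map (\<lambda>t. ((\<sigma> ^^ t) (\<sigma> i), (\<sigma> ^^ Suc t) (\<sigma> i))) [0..<m]"
    by (subst upt_conv_Cons) (auto simp: map_Suc_upt[symmetric] funpow_swap1 simp del: upt_Suc)
  then show ?case
    using Suc[of "\<sigma> i"] by (simp add: pre_digraph.cas.simps network_def funpow_swap1 del: upt_Suc)
qed

text \<open>
  The bridge from the determinant to the graph: a cycle of a permutation whose entries are
  all finite is a circuit.  Fixed points with a finite diagonal entry give the loops.
\<close>

lemma orbit_circuit: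
  fixes A :: "minplus ^ 'n ^ 'n"
  assumes \<sigma>: "\<sigma> permutes UNIV" and fin: "\<And>j. j \<in> orbit \<sigma> i \<Longrightarrow> A $ j $ \<sigma> j \<noteq> PInf"
  shows "(\<lambda>j. (j, \<sigma> j)) ` orbit \<sigma> i \<in> circuits A"
proof -
  have self: "i \<in> orbit \<sigma> i"
    using \<sigma> by (intro permutation_self_in_orbit) (auto simp: permutation_permutes)
  define m where "m = funpow_dist1 \<sigma> i i"
  define c where "c = map (\<lambda>t. ((\<sigma> ^^ t) i, (\<sigma> ^^ Suc t) i)) [0..<m]"
  have orb: "orbit \<sigma> i = (\<lambda>t. (\<sigma> ^^ t) i) ` {0..<m}"
    unfolding m_def by (rule orbit_conv_funpow_dist1[OF self])
  have setc: "set c = (\<lambda>j. (j, \<sigma> j)) ` orbit \<sigma> i"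
    unfolding c_def orb by auto
  have cas: "pre_digraph.cas (network A) i c i"
    using cas_funpow[of A i \<sigma> m] funpow_dist1_prop[OF self] by (simp add: c_def m_def)
  have "distinct (map fst c)"
    using inj_on_funpow_dist1[OF self]
    by (simp add: c_def m_def distinct_map o_def inj_on_def del: upt_Suc)
  moreover have "mset (map fst c @ [i]) = mset (i # map snd c)"
    using network_cas_map_fst[OF cas] by simp
  then have "mset (map fst c) = mset (map snd c)" by simp
  ultimately have "distinct (map snd c)" using mset_eq_imp_distinct_iff by blast
  moreover have "c \<noteq> []" by (simp add: c_def m_def)
  moreover have "set c \<subseteq> arcs (network A)"
    using fin by (auto simp: setc network_def)
  ultimately have "pre_digraph.cycle (network A) c"
    using cas unfolding pre_digraph.cycle_def pre_digraph.awalk_def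
    by (intro exI[of _ i]) (auto simp: network_cas_verts[OF cas], simp add: network_def)
  then show ?thesis unfolding circuits_def setc[symmetric] by blast
qed

lemma loop_circuit:
  fixes A :: "minplus ^ 'n ^ 'n"
  assumes "A $ i $ i \<noteq> PInf"
  shows "{(i, i)} \<in> circuits A"
  using orbit_circuit[of id i A] assms orbit_eq_singleton_iff[of id i] by (simp add: permutes_id)

lemma circuits_eqI:
  assumes "circuits_separated A" "C \<in> circuits A" "D \<in> circuits A"
    and "v \<in> circuit_verts C" "v \<in> circuit_verts D"
  shows "C = D"
  using assms unfolding circuits_separated_def Uniq_def by blast

lemma circuit_length_pos:
  fixes A :: "minplus ^ 'n ^ 'n"
  assumes "C \<in> circuits A"
  shows "circuit_length C > 0"
  using circuitD(1)[OF assms] by (simp add: circuit_length_def card_gt_0_iff)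

lemma card_circuit_verts: "C \<in> circuits A \<Longrightarrow> card (circuit_verts C) = circuit_length C"
  by (simp add: circuit_verts_def circuit_length_def card_image circuitD(2))

lemma circuit_weight_eq_average:
  fixes A :: "minplus ^ 'n ^ 'n"
  assumes "C \<in> circuits A"
  shows "circuit_weight A C = real (circuit_length C) * circuit_average A C"
  using circuit_length_pos[OF assms] by (simp add: circuit_average_def)

lemma circuit_weight_successor:
  assumes "C \<in> circuits A" "\<And>i j. (i, j) \<in> C \<Longrightarrow> j = s i"
  shows "circuit_weight A C = (\<Sum>i\<in>circuit_verts C. arc_weight A (i, s i))"
  unfolding circuit_weight_def circuit_verts_def
  using assms(2) by (subst sum.reindex[OF circuitD(2)[OF assms(1)]]) (auto intro!: sum.cong)

lemma circuit_average_loop: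
  "A $ i $ i = Fin a \<Longrightarrow> circuit_average A {(i, i)} = a"
  by (simp add: circuit_average_def circuit_weight_def circuit_length_def arc_weight_def)

lemma sum_vertices_by_circuits:
  fixes A :: "minplus ^ 'n ^ 'n" and w :: "'n \<Rightarrow> real"
  assumes "circuits_separated A"
  shows "(\<Sum>i\<in>UNIV. w i) = (\<Sum>C\<in>circuits A. \<Sum>i\<in>circuit_verts C. w i)
           + (\<Sum>i\<in>- \<Union>(circuit_verts ` circuits A). w i)"
proof -
  let ?V = "\<Union>(circuit_verts ` circuits A)"
  have "(\<Sum>i\<in>UNIV. w i) = sum w ?V + sum w (- ?V)"
    unfolding Compl_eq_Diff_UNIV by (subst add.commute, rule sum.subset_diff) auto
  also have "sum w ?V = (\<Sum>C\<in>circuits A. sum w (circuit_verts C))"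
    using circuits_eqI[OF assms] by (intro sum.UNION_disjoint) auto
  finally show ?thesis .
qed


section \<open>The characteristic function of a matrix with separated circuits\<close>

text \<open>
  Disjoint circuits can be traversed simultaneously by one permutation that leaves all other
  vertices fixed.
\<close>

lemma union_of_circuits_permutation:
  fixes A :: "minplus ^ 'n ^ 'n"
  assumes sep: "circuits_separated A" and S: "S \<subseteq> circuits A"
  obtains \<sigma> where "\<sigma> permutes UNIV" "\<And>i j. (i, j) \<in> \<Union>S \<Longrightarrow> \<sigma> i = j"
    "\<And>i. i \<notin> fst ` \<Union>S \<Longrightarrow> \<sigma> i = i"
proof -
  define U where "U = \<Union>S"
  define V where "V = fst ` U"
  have inj: "inj_on fst U"
  proof (rule inj_onI)
    fix e f assume e: "e \<in> U" and f: "f \<in> U" and eq: "fst e = fst f"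
    obtain C D where C: "C \<in> S" "e \<in> C" and D: "D \<in> S" "f \<in> D"
      using e f by (auto simp: U_def)
    have "fst e \<in> circuit_verts C" "fst e \<in> circuit_verts D"
      using imageI[OF C(2), of fst] imageI[OF D(2), of fst] eq by (simp_all add: circuit_verts_def)
    then have "C = D" using C D S by (intro circuits_eqI[OF sep]) auto
    then show "e = f" using C D S circuitD(2) eq by (metis inj_onD subsetD)
  qed
  \<comment> \<open>Each circuit has as many heads as tails, so the arcs in \<open>U\<close> also have distinct heads.\<close>
  have im: "snd ` U = V"
    using S circuitD(3) unfolding U_def V_def image_Union by (metis (no_types, lifting) image_cong subsetD)
  have "card (snd ` U) = card U" using im inj by (simp add: V_def card_image)
  then have inj2: "inj_on snd U" by (intro eq_card_imp_inj_on) auto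
  define s where "s = snd \<circ> inv_into U fst"
  have s: "s i = j" if "(i, j) \<in> U" for i j
    using inv_into_f_f[OF inj that] by (simp add: s_def)
  have "bij_betw (inv_into U fst) V U"
    using inj by (intro bij_betw_inv_into) (auto simp: bij_betw_def V_def)
  moreover have "bij_betw snd U V" using inj2 im by (simp add: bij_betw_def)
  ultimately have "bij_betw s V V" unfolding s_def by (rule bij_betw_trans)
  then have "bij_betw (\<lambda>i. if i \<in> V then s i else i) V V"
    by (simp cong: bij_betw_cong)
  then have "(\<lambda>i. if i \<in> V then s i else i) permutes V"
    by (rule bij_imp_permutes) auto
  then have "(\<lambda>i. if i \<in> V then s i else i) permutes UNIV"
    by (rule permutes_subset) auto
  moreover have "i \<in> V" if "(i, j) \<in> U" for i j
    using imageI[OF that, of fst] by (simp add: V_def)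
  ultimately show ?thesis
    using s by (intro that[of "\<lambda>i. if i \<in> V then s i else i"]) (simp_all only: U_def V_def if_True if_False)
qed

text \<open>
  A vertex moved by \<open>\<tau>\<close> has its whole orbit moved, so along this orbit only
  off-diagonal entries are used, and these do not involve \<open>x\<close>.
\<close>

lemma moved_vertex_circuit:
  fixes A :: "minplus ^ 'n ^ 'n"
  assumes \<tau>: "\<tau> permutes UNIV"
    and u: "\<And>i. char_matrix A x $ i $ \<tau> i = Fin (u i)"
    and i: "\<tau> i \<noteq> i"
  shows "(\<lambda>j. (j, \<tau> j)) ` orbit \<tau> i \<in> circuits A"
    and "i \<in> circuit_verts ((\<lambda>j. (j, \<tau> j)) ` orbit \<tau> i)"
    and "\<And>j. j \<in> orbit \<tau> i \<Longrightarrow> A $ j $ \<tau> j = Fin (u j)"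
proof -
  have moved: "\<tau> j \<noteq> j" if "j \<in> orbit \<tau> i" for j
    using that
  proof induction
    case base
    then show ?case using i by (simp add: inj_eq[OF permutes_inj[OF \<tau>]])
  next
    case (step j)
    then show ?case by (simp add: inj_eq[OF permutes_inj[OF \<tau>]])
  qed
  show Au: "A $ j $ \<tau> j = Fin (u j)" if "j \<in> orbit \<tau> i" for j
    using u[of j] moved[OF that]
    by (simp add: char_matrix_nth)
  show "(\<lambda>j. (j, \<tau> j)) ` orbit \<tau> i \<in> circuits A"
    using Au by (intro orbit_circuit[OF \<tau>]) auto
  have "i \<in> orbit \<tau> i"
    using \<tau> by (intro permutation_self_in_orbit) (auto simp: permutation_permutes)
  then show "i \<in> circuit_verts ((\<lambda>j. (j, \<tau> j)) ` orbit \<tau> i)"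
    by (force simp: circuit_verts_def)
qed

text \<open>
  If \<open>\<tau>\<close> moves some vertex of \<open>C\<close>, the orbit of this vertex is a circuit, which by separation
  must be \<open>C\<close> itself: \<open>\<tau>\<close> cannot leave \<open>C\<close> or follow it only in part.  Otherwise \<open>\<tau>\<close> fixes all
  vertices of \<open>C\<close>, and a finite diagonal entry, being a loop, can occur only if \<open>C\<close> is that loop.
\<close>

lemma permutation_weight_on_circuit_ge:
  fixes A :: "minplus ^ 'n ^ 'n"
  assumes sep: "circuits_separated A" and C: "C \<in> circuits A" and \<tau>: "\<tau> permutes UNIV"
    and u: "\<And>i. char_matrix A (Fin x) $ i $ \<tau> i = Fin (u i)"
  shows "real (circuit_length C) * min x (circuit_average A C) \<le> (\<Sum>i\<in>circuit_verts C. u i)"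
proof (cases "\<exists>i\<in>circuit_verts C. \<tau> i \<noteq> i")
  case True
  then obtain i where i: "i \<in> circuit_verts C" "\<tau> i \<noteq> i" by blast
  note D = moved_vertex_circuit[OF \<tau> u i(2)]
  let ?D = "(\<lambda>j. (j, \<tau> j)) ` orbit \<tau> i"
  have CD: "C = ?D" by (rule circuits_eqI[OF sep C D(1) i(1) D(2)])
  have "circuit_weight A C = (\<Sum>j\<in>circuit_verts C. arc_weight A (j, \<tau> j))"
    by (rule circuit_weight_successor[OF C]) (auto simp: CD)
  also have "\<dots> = (\<Sum>j\<in>circuit_verts C. u j)"
    using D(3) by (intro sum.cong) (auto simp: CD circuit_verts_def arc_weight_def)
  finally have "real (circuit_length C) * circuit_average A C = (\<Sum>j\<in>circuit_verts C. u j)"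
    using circuit_weight_eq_average[OF C] by simp
  then show ?thesis by (metis min.cobounded2 mult_left_mono of_nat_0_le_iff)
next
  case False
  have "min x (circuit_average A C) \<le> u i" if i: "i \<in> circuit_verts C" for i
  proof (cases "A $ i $ i")
    case (Fin a)
    then have "C = {(i, i)}"
      using circuits_eqI[OF sep C loop_circuit[of A i]] i by (simp add: circuit_verts_def)
    then show ?thesis
      using u[of i] Fin False i by (auto simp: char_matrix_nth circuit_average_loop)
  next
    case PInf
    then show ?thesis using u[of i] False i by (auto simp: char_matrix_nth)
  qed
  then have "real (card (circuit_verts C)) * min x (circuit_average A C) \<le> (\<Sum>i\<in>circuit_verts C. u i)"
    by (intro sum_bounded_below)
  then show ?thesis by (simp add: card_circuit_verts[OF C])
qed

text \<open>
  The optimal permutation goes round exactly the circuits of average weight at most \<open>x\<close>.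
\<close>

theorem char_fun_separated:
  fixes A :: "minplus ^ 'n ^ 'n"
  assumes sep: "circuits_separated A"
  shows "char_fun A (Fin x) =
    Fin ((\<Sum>C\<in>circuits A. real (circuit_length C) * min x (circuit_average A C))
         + real (card (- \<Union>(circuit_verts ` circuits A))) * x)"
proof -
  let ?R = "- \<Union>(circuit_verts ` circuits A)"
  let ?M = "char_matrix A (Fin x)"
  define S where "S = {C \<in> circuits A. circuit_average A C \<le> x}"
  obtain \<sigma> where \<sigma>: "\<sigma> permutes UNIV" and on: "\<And>i j. (i, j) \<in> \<Union>S \<Longrightarrow> \<sigma> i = j"
    and off: "\<And>i. i \<notin> fst ` \<Union>S \<Longrightarrow> \<sigma> i = i"
    using union_of_circuits_permutation[OF sep, of S] by (auto simp: S_def)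
  define w where "w i = (if i \<in> fst ` \<Union>S then arc_weight A (i, \<sigma> i) else x)" for i
  show ?thesis
    unfolding char_fun_eq_tropdet
  proof (rule tropdet_eq_Fin[OF \<sigma>, where w = w])
    fix i
    \<comment> \<open>On the diagonal the entry is a minimum, and the choice of \<open>S\<close> picks the smaller term:
      a loop is in \<open>S\<close> exactly when its weight is at most \<open>x\<close>.\<close>
    have loop: "a \<le> x \<longleftrightarrow> {(i, i)} \<in> S" if "A $ i $ i = Fin a" for a
      using that loop_circuit[of A i] by (simp add: S_def circuit_average_loop)
    show "?M $ i $ \<sigma> i = Fin (w i)"
    proof (cases "i \<in> fst ` \<Union>S")
      case True
      then obtain C where C: "C \<in> S" "i \<in> circuit_verts C" by (auto simp: circuit_verts_def)
      then have arc: "(i, \<sigma> i) \<in> C" using on by (fastforce simp: circuit_verts_def)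
      then obtain a where a: "A $ i $ \<sigma> i = Fin a"
        using circuitD(4)[of C A i "\<sigma> i"] C by (cases "A $ i $ \<sigma> i") (auto simp: S_def)
      have "a \<le> x" if "\<sigma> i = i"
      proof -
        have "C = {(i, i)}"
          using circuits_eqI[OF sep _ loop_circuit[of A i], of C i] a C that
          by (simp add: S_def circuit_verts_def)
        then show ?thesis using loop C a that by simp
      qed
      then show ?thesis using True a by (auto simp: w_def arc_weight_def char_matrix_nth)
    next
      case False
      have "x \<le> a" if "A $ i $ i = Fin a" for a
        using loop[OF that] False by force
      then show ?thesis
        using False off[of i] by (cases "A $ i $ i") (auto simp: w_def char_matrix_nth)
    qed
  next
    have "(\<Sum>i\<in>circuit_verts C. w i) = real (circuit_length C) * min x (circuit_average A C)"
      if C: "C \<in> circuits A" for C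
    proof (cases "C \<in> S")
      case True
      have "circuit_weight A C = (\<Sum>i\<in>circuit_verts C. arc_weight A (i, \<sigma> i))"
        by (rule circuit_weight_successor[OF C]) (use on True in auto)
      also have "\<dots> = (\<Sum>i\<in>circuit_verts C. w i)"
        using True by (intro sum.cong) (auto simp: w_def circuit_verts_def)
      finally show ?thesis
        using True circuit_weight_eq_average[OF C] by (simp add: S_def min_absorb2)
    next
      case False
      have "w i = x" if i: "i \<in> circuit_verts C" for i
      proof -
        have "i \<notin> circuit_verts D" if "D \<in> S" for D
          using circuits_eqI[OF sep C _ i, of D] that False by (auto simp: S_def)
        then show ?thesis by (auto simp: w_def circuit_verts_def)
      qed
      then show ?thesis
        using False C by (simp add: S_def card_circuit_verts[OF C] min_def)
    qed
    moreover have "w i = x" if "i \<in> ?R" for i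
      using that by (auto simp: w_def S_def circuit_verts_def)
    ultimately show "(\<Sum>i\<in>UNIV. w i) =
      (\<Sum>C\<in>circuits A. real (circuit_length C) * min x (circuit_average A C)) + real (card ?R) * x"
      by (simp add: sum_vertices_by_circuits[OF sep])
  next
    fix \<tau> :: "'n \<Rightarrow> 'n" and u
    assume \<tau>: "\<tau> permutes UNIV" and u: "\<And>i. ?M $ i $ \<tau> i = Fin (u i)"
    have "u i = x" if i: "i \<in> ?R" for i
    proof -
      have nc: "i \<notin> circuit_verts C" if "C \<in> circuits A" for C using i that by auto
      have "A $ i $ i = PInf" using nc[OF loop_circuit[of A i]] by (auto simp: circuit_verts_def)
      moreover have "\<tau> i = i"
        using moved_vertex_circuit(1,2)[OF \<tau> u, of i] nc by blast
      ultimately show ?thesis using u[of i] by (simp add: char_matrix_nth)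
    qed
    then have "(\<Sum>i\<in>?R. u i) = real (card ?R) * x" by simp
    moreover have "(\<Sum>C\<in>circuits A. real (circuit_length C) * min x (circuit_average A C))
        \<le> (\<Sum>C\<in>circuits A. \<Sum>i\<in>circuit_verts C. u i)"
      using permutation_weight_on_circuit_ge[OF sep _ \<tau> u] by (intro sum_mono) auto
    ultimately show "(\<Sum>C\<in>circuits A. real (circuit_length C) * min x (circuit_average A C))
        + real (card ?R) * x \<le> (\<Sum>i\<in>UNIV. u i)"
      by (simp add: sum_vertices_by_circuits[OF sep])
  qed
qed


section \<open>Breakpoints of piecewise linear function_eq\<close>

text \<open>
  The second difference at \<open>q\<close> kills linear terms.  With a step \<open>\<delta>\<close> too short to pass any other
  breakpoint, every \<open>min x (a i)\<close> with \<open>a i \<noteq> q\<close> is linear on the interval used, so only the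
  terms that break at \<open>q\<close> survive.
\<close>

lemma second_difference_min_sum:
  fixes m a :: "'i \<Rightarrow> real"
  assumes "finite I" "\<delta> > 0" "\<And>i. i \<in> I \<Longrightarrow> a i \<noteq> q \<Longrightarrow> \<delta> \<le> \<bar>a i - q\<bar>"
    and f: "\<And>x. f x = (\<Sum>i\<in>I. m i * min x (a i)) + c * x"
  shows "f (q + \<delta>) + f (q - \<delta>) - 2 * f q = - \<delta> * (\<Sum>i | i \<in> I \<and> a i = q. m i)"
proof -
  have "f (q + \<delta>) + f (q - \<delta>) - 2 * f q =
    (\<Sum>i\<in>I. m i * (min (q + \<delta>) (a i) + min (q - \<delta>) (a i) - 2 * min q (a i)))"
    unfolding f
    by (simp add: algebra_simps sum.distrib sum_subtractf sum_distrib_left)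
  also have "\<dots> = (\<Sum>i\<in>I. if a i = q then m i * (- \<delta>) else 0)"
  proof (rule sum.cong[OF refl])
    fix i assume i: "i \<in> I"
    show "m i * (min (q + \<delta>) (a i) + min (q - \<delta>) (a i) - 2 * min q (a i)) =
      (if a i = q then m i * (- \<delta>) else 0)"
    proof (cases "a i = q")
      case True
      then show ?thesis using assms(2) by simp
    next
      case False
      then have "min (q + \<delta>) (a i) + min (q - \<delta>) (a i) - 2 * min q (a i) = 0"
        using assms(2) assms(3)[OF i] by (auto simp: min_def abs_if split: if_splits)
      then show ?thesis using False by simp
    qed
  qed
  also have "\<dots> = - \<delta> * (\<Sum>i | i \<in> I \<and> a i = q. m i)"
    using assms(1)
    by (simp add: sum.inter_filter[symmetric] sum_distrib_left mult.commute sum_negf)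
  finally show ?thesis .
qed

lemma breakpoint_weights_unique:
  fixes m a :: "'i \<Rightarrow> real" and n b :: "'j \<Rightarrow> real"
  assumes fin: "finite I" "finite J"
    and eq: "\<And>x. (\<Sum>i\<in>I. m i * min x (a i)) + c * x = (\<Sum>j\<in>J. n j * min x (b j)) + d * x"
  shows "(\<Sum>i | i \<in> I \<and> a i = q. m i) = (\<Sum>j | j \<in> J \<and> b j = q. n j)"
proof -
  let ?B = "(\<lambda>s. \<bar>s - q\<bar>) ` (a ` I \<union> b ` J - {q})"
  \<comment> \<open>The added \<open>1\<close> only keeps the minimum defined when there is no breakpoint besides \<open>q\<close>.\<close>
  define \<delta> where "\<delta> = Min (insert 1 ?B)"
  have pos: "\<delta> > 0" using fin by (auto simp: \<delta>_def)
  have le: "\<delta> \<le> \<bar>s - q\<bar>" if "s \<in> a ` I \<union> b ` J" "s \<noteq> q" for s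
    unfolding \<delta>_def using fin that by (intro Min_le) auto
  define f where "f x = (\<Sum>i\<in>I. m i * min x (a i)) + c * x" for x
  have "f (q + \<delta>) + f (q - \<delta>) - 2 * f q = - \<delta> * (\<Sum>i | i \<in> I \<and> a i = q. m i)"
    using le by (intro second_difference_min_sum[OF fin(1) pos _ f_def]) auto
  moreover have "f (q + \<delta>) + f (q - \<delta>) - 2 * f q = - \<delta> * (\<Sum>j | j \<in> J \<and> b j = q. n j)"
    using le by (intro second_difference_min_sum[OF fin(2) pos _ f_def[unfolded eq]]) auto
  ultimately have "- \<delta> * (\<Sum>i | i \<in> I \<and> a i = q. m i) = - \<delta> * (\<Sum>j | j \<in> J \<and> b j = q. n j)"
    by linarith
  then show ?thesis using pos by simp
qed


section \<open>Extended circuits from linear factors\<close>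

theorem theorem5p4:
  fixes A :: "minplus ^ 'n ^ 'n"
    and k r :: nat
    and p :: "nat \<Rightarrow> real"
    and l :: "nat \<Rightarrow> nat"
  assumes "circuits_separated A"
    and "strict_mono_on {1..k} p"
    and "\<forall>i\<in>{1..k}. 0 < l i"
    and "(\<Sum>i=1..k. l i) \<le> CARD('n)"
    and "r = CARD('n) - (\<Sum>i=1..k. l i)"
    and "\<forall>x::minplus. char_fun A x = (\<Prod>i=1..k. (x + Fin (p i)) ^ l i) * x ^ r"
  shows "\<forall>i\<in>{1..k}. \<exists>E. extended_circuit A E \<and> homogeneous A E
           \<and> ext_length E = l i \<and> ext_average A E = p i"
proof
  fix i assume i: "i \<in> {1..k}"
  let ?len = "\<lambda>C. real (circuit_length C)"
  let ?R = "- \<Union>(circuit_verts ` circuits A)"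
  define E where "E = {C \<in> circuits A. circuit_average A C = p i}"
  have function_eq: "(\<Sum>C\<in>circuits A. ?len C * min x (circuit_average A C)) + real (card ?R) * x
      = (\<Sum>j\<in>{1..k}. real (l j) * min x (p j)) + real r * x" for x
    using assms(6)[rule_format, of "Fin x"]
    by (simp add: char_fun_separated[OF assms(1)] Fin_power prod_Fin)
  have "(\<Sum>C\<in>E. ?len C) = (\<Sum>j | j \<in> {1..k} \<and> p j = p i. real (l j))"
    unfolding E_def by (rule breakpoint_weights_unique[OF _ _ function_eq]) auto
  also have "{j. j \<in> {1..k} \<and> p j = p i} = {i}"
    using i strict_mono_on_imp_inj_on[OF assms(2)] by (auto dest: inj_onD)
  finally have len: "(\<Sum>C\<in>E. ?len C) = real (l i)" by simp
  then have "real (ext_length E) = real (l i)" by (simp add: ext_length_def)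
  then have length: "ext_length E = l i" by linarith
  have "ext_weight A E = (\<Sum>C\<in>E. ?len C * p i)"
    unfolding ext_weight_def
    by (intro sum.cong) (auto simp: E_def circuit_weight_eq_average)
  also have "\<dots> = real (l i) * p i" by (simp add: len sum_distrib_right[symmetric])
  finally have average: "ext_average A E = p i"
    using assms(3) i length by (simp add: ext_average_def)
  have "extended_circuit A E"
    unfolding extended_circuit_def pairwise_def disjnt_def
    using circuits_eqI[OF assms(1)] by (auto simp: E_def)
  moreover have "homogeneous A E" unfolding homogeneous_def average by (simp add: E_def)
  ultimately show "\<exists>E. extended_circuit A E \<and> homogeneous A E
      \<and> ext_length E = l i \<and> ext_average A E = p i"
    using length average by blast
qed

end
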